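(* Let $m\ge 1$, let $\mathcal{D}$ be a triangulated category with a bounded $t$-structure $(\mathcal{D}^{\le0},\mathcal{D}^{\ge0})$, and let $(\mathcal{T},\mathcal{F})$ be a torsion pair in $\mathcal{D}^{[-(m-1),0]}$. The following are equivalent. (1) $(\mathcal{T},\mathcal{F})$ is an $s$-torsion pair. (2) $\mathcal{T}$ is closed under $m$-factors, i.e. $\mathrm{Fac}_m(\mathcal{T})\subseteq\mathcal{T}$. (3) $\mathcal{F}$ is closed under $m$-subobjects, i.e. $\mathrm{Sub}_m(\mathcal{F})\subseteq\mathcal{F}$.
   Context: All categories are additive; subcategories are full, additive and closed under isomorphisms. $\mathrm{Hom}$ is taken in $\mathcal{D}$. For subcategories $\mathcal{X},\mathcal{Y}$, $\mathcal{X}*\mathcal{Y}$ is the subcategory of objects $Z$ admitting a triangle $X\to Z\to Y\to X[1]$ with $X\in\mathcal{X}$, $Y\in\mathcal{Y}$. A bounded $t$-structure is a pair of subcategories with: $\mathcal{D}^{\le 0}[1]\subseteq\mathcal{D}^{\le 0}$, $\mathcal{D}^{\ge 0}[-1]\subseteq\mathcal{D}^{\ge 0}$; $\mathrm{Hom}(\mathcal{D}^{\le 0},\mathcal{D}^{\ge 0}[-1])=0$; $\mathcal{D}=\mathcal{D}^{\le 0}*\mathcal{D}^{\ge 0}[-1]$; and for each $X\in\mathcal{D}$ there is $n>0$ with $X[n]\in\mathcal{D}^{\le 0}$, $X[-n]\in\mathcal{D}^{\ge 0}$. Put $\mathcal{D}^{\le p}=\mathcal{D}^{\le 0}[-p]$,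 $\mathcal{D}^{\ge p}=\mathcal{D}^{\ge 0}[-p]$, $\mathcal{D}^{[p,q]}=\mathcal{D}^{\ge p}\cap\mathcal{D}^{\le q}$. A torsion pair in $\mathcal{D}^{[-(m-1),0]}$ is a pair $(\mathcal{T},\mathcal{F})$ of subcategories of $\mathcal{D}^{[-(m-1),0]}$ with $\mathrm{Hom}(\mathcal{T},\mathcal{F})=0$ and $\mathcal{D}^{[-(m-1),0]}=\mathcal{T}*\mathcal{F}$; it is an $s$-torsion pair if moreover $\mathrm{Hom}(\mathcal{T},\mathcal{F}[-1])=0$. For a subcategory $\mathcal{X}$ of $\mathcal{D}^{[-(m-1),0]}$: $\mathrm{Fac}_m(\mathcal{X})$ consists of the objects $Z\in\mathcal{D}^{[-(m-1),0]}$ for which there are triangles $Z_i\to X_i\to Z_{i-1}\to Z_i[1]$, $1\le i\le m$, with $Z_0=Z$, $Z_1,\dots,Z_m\in\mathcal{D}^{[-(m-1),0]}$, $X_1,\dots,X_m\in\mathcal{X}$. $\mathrm{Sub}_m(\mathcal{X})$ consists of the objects $Z\in\mathcal{D}^{[-(m-1),0]}$ for which there are triangles $Z_{i-1}\to X_i\to Z_i\to Z_{i-1}[1]$, $1\le i\le m$, with $Z_0=Z$, $Z_1,\dots,Z_m\in\mathcal{D}^{[-(m-1),0]}$, $X_1,\dots,X_m\in\mathcal{X}$. *)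

theory Defs
  imports "HOL-Algebra.Group"
begin

section \<open>Additive categories\<close>

text \<open>
  The arrow type carries domain and codomain, so hom-sets of distinct pairs of objects are
  disjoint. \<open>g \<cdot> f\<close> is composition in the usual order (first \<open>f\<close>, then \<open>g\<close>).
\<close>

record ('o, 'a) category =
  Obj :: "'o set"
  Arr :: "'a set"
  Dom :: "'a \<Rightarrow> 'o"
  Cod :: "'a \<Rightarrow> 'o"
  Id :: "'o \<Rightarrow> 'a"
  Comp :: "'a \<Rightarrow> 'a \<Rightarrow> 'a"  (infixr "\<cdot>\<index>" 75)

definition Hom :: "('o, 'a, 'z) category_scheme \<Rightarrow> 'o \<Rightarrow> 'o \<Rightarrow> 'a set"
  where "Hom C X Y = {f \<in> Arr C. Dom C f = X \<and> Cod C f = Y}"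

locale category =
  fixes C (structure)
  assumes Dom_Obj: "f \<in> Arr C \<Longrightarrow> Dom C f \<in> Obj C"
    and Cod_Obj: "f \<in> Arr C \<Longrightarrow> Cod C f \<in> Obj C"
    and Id_Hom: "X \<in> Obj C \<Longrightarrow> Id C X \<in> Hom C X X"
    and Comp_Hom: "\<lbrakk>f \<in> Hom C X Y; g \<in> Hom C Y Z\<rbrakk> \<Longrightarrow> g \<cdot> f \<in> Hom C X Z"
    and Comp_assoc: "\<lbrakk>f \<in> Hom C W X; g \<in> Hom C X Y; h \<in> Hom C Y Z\<rbrakk>
      \<Longrightarrow> (h \<cdot> g) \<cdot> f = h \<cdot> (g \<cdot> f)"
    and Comp_Id: "f \<in> Hom C X Y \<Longrightarrow> f \<cdot> Id C X = f"
    and Id_Comp: "f \<in> Hom C X Y \<Longrightarrow> Id C Y \<cdot> f = f"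

definition is_iso :: "('o, 'a, 'z) category_scheme \<Rightarrow> 'o \<Rightarrow> 'o \<Rightarrow> 'a \<Rightarrow> bool"
  where "is_iso C X Y f \<longleftrightarrow> f \<in> Hom C X Y \<and>
    (\<exists>g \<in> Hom C Y X. g \<cdot>\<^bsub>C\<^esub> f = Id C X \<and> f \<cdot>\<^bsub>C\<^esub> g = Id C Y)"

definition isomorphic :: "('o, 'a, 'z) category_scheme \<Rightarrow> 'o \<Rightarrow> 'o \<Rightarrow> bool"
  where "isomorphic C X Y \<longleftrightarrow> (\<exists>f. is_iso C X Y f)"

definition zero_object :: "('o, 'a, 'z) category_scheme \<Rightarrow> 'o \<Rightarrow> bool"
  where "zero_object C Z \<longleftrightarrow> Z \<in> Obj C \<and>
    (\<forall>X \<in> Obj C. (\<exists>!f. f \<in> Hom C X Z) \<and> (\<exists>!f. f \<in> Hom C Z X))"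

record ('o, 'a) additive_category = "('o, 'a) category" +
  Add :: "'a \<Rightarrow> 'a \<Rightarrow> 'a"
  Zero :: "'o \<Rightarrow> 'o \<Rightarrow> 'a"

definition hom_group :: "('o, 'a, 'z) additive_category_scheme \<Rightarrow> 'o \<Rightarrow> 'o \<Rightarrow> 'a monoid"
  where "hom_group C X Y = \<lparr>carrier = Hom C X Y, mult = Add C, one = Zero C X Y\<rparr>"

definition Neg :: "('o, 'a, 'z) additive_category_scheme \<Rightarrow> 'a \<Rightarrow> 'a"
  where "Neg C f = inv\<^bsub>hom_group C (Dom C f) (Cod C f)\<^esub> f"

definition is_biproduct ::
    "('o, 'a, 'z) additive_category_scheme \<Rightarrow> 'o \<Rightarrow> 'o \<Rightarrow> 'o \<Rightarrow> bool"
  where "is_biproduct C X Y S \<longleftrightarrow>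
    (\<exists>i \<in> Hom C X S. \<exists>j \<in> Hom C Y S. \<exists>p \<in> Hom C S X. \<exists>q \<in> Hom C S Y.
       p \<cdot>\<^bsub>C\<^esub> i = Id C X \<and> q \<cdot>\<^bsub>C\<^esub> j = Id C Y \<and>
       q \<cdot>\<^bsub>C\<^esub> i = Zero C X Y \<and> p \<cdot>\<^bsub>C\<^esub> j = Zero C Y X \<and>
       Add C (i \<cdot>\<^bsub>C\<^esub> p) (j \<cdot>\<^bsub>C\<^esub> q) = Id C S)"

locale additive_category = category C for C (structure) +
  assumes hom_group: "\<lbrakk>X \<in> Obj C; Y \<in> Obj C\<rbrakk> \<Longrightarrow> comm_group (hom_group C X Y)"
    and Comp_Add: "\<lbrakk>f \<in> Hom C X Y; f' \<in> Hom C X Y; g \<in> Hom C Y Z\<rbrakk>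
      \<Longrightarrow> g \<cdot> Add C f f' = Add C (g \<cdot> f) (g \<cdot> f')"
    and Add_Comp: "\<lbrakk>f \<in> Hom C X Y; g \<in> Hom C Y Z; g' \<in> Hom C Y Z\<rbrakk>
      \<Longrightarrow> Add C g g' \<cdot> f = Add C (g \<cdot> f) (g' \<cdot> f)"
    and ex_zero_object: "\<exists>Z. zero_object C Z"
    and ex_biproduct: "\<lbrakk>X \<in> Obj C; Y \<in> Obj C\<rbrakk> \<Longrightarrow> \<exists>S \<in> Obj C. is_biproduct C X Y S"

text \<open>
  Full subcategories that are additive and closed under isomorphisms are identified with
  their sets of objects.
\<close>

definition subcategory :: "('o, 'a, 'z) additive_category_scheme \<Rightarrow> 'o set \<Rightarrow> bool"
  where "subcategory C A \<longleftrightarrow> A \<subseteq> Obj C \<and>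
    (\<forall>X \<in> A. \<forall>Y \<in> Obj C. isomorphic C X Y \<longrightarrow> Y \<in> A) \<and>
    (\<exists>Z \<in> A. zero_object C Z) \<and>
    (\<forall>X \<in> A. \<forall>Y \<in> A. \<forall>S \<in> Obj C. is_biproduct C X Y S \<longrightarrow> S \<in> A)"

definition Hom_vanish ::
    "('o, 'a, 'z) additive_category_scheme \<Rightarrow> 'o set \<Rightarrow> 'o set \<Rightarrow> bool"
  where "Hom_vanish C A B \<longleftrightarrow> (\<forall>X \<in> A. \<forall>Y \<in> B. Hom C X Y = {Zero C X Y})"


section \<open>Triangulated categories\<close>

text \<open>
  \<open>Sh\<close> and \<open>ShA\<close> are the action of the shift functor \<open>[1]\<close> on objects and on arrows;
  \<open>Dist C f g h\<close> says that \<open>X \<rightarrow> Y \<rightarrow> Z \<rightarrow> X[1]\<close> with arrows \<open>f\<close>, \<open>g\<close>, \<open>h\<close> is a distinguished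
  triangle.
\<close>

record ('o, 'a) triangulated_category = "('o, 'a) additive_category" +
  Sh :: "'o \<Rightarrow> 'o"
  ShA :: "'a \<Rightarrow> 'a"
  Dist :: "'a \<Rightarrow> 'a \<Rightarrow> 'a \<Rightarrow> bool"

definition candidate_triangle ::
    "('o, 'a, 'z) triangulated_category_scheme \<Rightarrow> 'o \<Rightarrow> 'o \<Rightarrow> 'o \<Rightarrow> 'a \<Rightarrow> 'a \<Rightarrow> 'a \<Rightarrow> bool"
  where "candidate_triangle C X Y Z f g h \<longleftrightarrow>
    f \<in> Hom C X Y \<and> g \<in> Hom C Y Z \<and> h \<in> Hom C Z (Sh C X)"

definition triangle ::
    "('o, 'a, 'z) triangulated_category_scheme \<Rightarrow> 'o \<Rightarrow> 'o \<Rightarrow> 'o \<Rightarrow> 'a \<Rightarrow> 'a \<Rightarrow> 'a \<Rightarrow> bool"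
  where "triangle C X Y Z f g h \<longleftrightarrow> candidate_triangle C X Y Z f g h \<and> Dist C f g h"

text \<open>
  The shift is an automorphism, not merely an autoequivalence, of the additive category;
  so the \<open>n\<close>-fold shift is a strict operation for every integer \<open>n\<close>.
\<close>

locale triangulated_category = additive_category C for C (structure) +
  assumes Sh_bij: "bij_betw (Sh C) (Obj C) (Obj C)"
    and ShA_bij: "\<lbrakk>X \<in> Obj C; Y \<in> Obj C\<rbrakk>
      \<Longrightarrow> bij_betw (ShA C) (Hom C X Y) (Hom C (Sh C X) (Sh C Y))"
    and ShA_Id: "X \<in> Obj C \<Longrightarrow> ShA C (Id C X) = Id C (Sh C X)"
    and ShA_Comp: "\<lbrakk>f \<in> Hom C X Y; g \<in> Hom C Y Z\<rbrakk> \<Longrightarrow> ShA C (g \<cdot> f) = ShA C g \<cdot> ShA C f"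
    and ShA_Add: "\<lbrakk>f \<in> Hom C X Y; f' \<in> Hom C X Y\<rbrakk>
      \<Longrightarrow> ShA C (Add C f f') = Add C (ShA C f) (ShA C f')"
    and Dist_candidate: "Dist C f g h \<Longrightarrow> \<exists>X Y Z. candidate_triangle C X Y Z f g h"
    and TR1_iso: "\<lbrakk>triangle C X Y Z f g h; candidate_triangle C X' Y' Z' f' g' h';
        is_iso C X X' a; is_iso C Y Y' b; is_iso C Z Z' c;
        b \<cdot> f = f' \<cdot> a; c \<cdot> g = g' \<cdot> b; ShA C a \<cdot> h = h' \<cdot> c\<rbrakk>
      \<Longrightarrow> triangle C X' Y' Z' f' g' h'"
    and TR1_id: "\<lbrakk>X \<in> Obj C; zero_object C Z\<rbrakk>
      \<Longrightarrow> triangle C X X Z (Id C X) (Zero C X Z) (Zero C Z (Sh C X))"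
    and TR1_cone: "f \<in> Hom C X Y \<Longrightarrow> \<exists>Z g h. triangle C X Y Z f g h"
    and TR2: "candidate_triangle C X Y Z f g h
      \<Longrightarrow> triangle C X Y Z f g h \<longleftrightarrow> triangle C Y Z (Sh C X) g h (Neg C (ShA C f))"
    and TR3: "\<lbrakk>triangle C X Y Z f g h; triangle C X' Y' Z' f' g' h';
        a \<in> Hom C X X'; b \<in> Hom C Y Y'; b \<cdot> f = f' \<cdot> a\<rbrakk>
      \<Longrightarrow> \<exists>c \<in> Hom C Z Z'. c \<cdot> g = g' \<cdot> b \<and> ShA C a \<cdot> h = h' \<cdot> c"
    and TR4: "\<lbrakk>triangle C X Y P f p d; triangle C Y Z R g r e; triangle C X Z Q (g \<cdot> f) q k\<rbrakk>
      \<Longrightarrow> \<exists>u v. triangle C P Q R u v (ShA C p \<cdot> e) \<and>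
            u \<cdot> p = q \<cdot> g \<and> k \<cdot> u = d \<and> v \<cdot> q = r \<and> e \<cdot> v = ShA C f \<cdot> k"

definition shift :: "('o, 'a, 'z) triangulated_category_scheme \<Rightarrow> int \<Rightarrow> 'o \<Rightarrow> 'o"
  where "shift C n X =
    (if 0 \<le> n then (Sh C ^^ nat n) X else (inv_into (Obj C) (Sh C) ^^ nat (- n)) X)"

definition shift_set :: "('o, 'a, 'z) triangulated_category_scheme \<Rightarrow> int \<Rightarrow> 'o set \<Rightarrow> 'o set"
  where "shift_set C n A = shift C n ` A"

definition ex_triangle :: "('o, 'a, 'z) triangulated_category_scheme \<Rightarrow> 'o \<Rightarrow> 'o \<Rightarrow> 'o \<Rightarrow> bool"
  where "ex_triangle C X Y Z \<longleftrightarrow> (\<exists>f g h. triangle C X Y Z f g h)"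

definition star ::
    "('o, 'a, 'z) triangulated_category_scheme \<Rightarrow> 'o set \<Rightarrow> 'o set \<Rightarrow> 'o set"
  where "star C A B = {Z \<in> Obj C. \<exists>X \<in> A. \<exists>Y \<in> B. ex_triangle C X Z Y}"


section \<open>Bounded t-structures, torsion pairs, factors and subobjects\<close>

text \<open>
  \<open>L\<close> is the aisle (degrees at most 0), \<open>G\<close> the coaisle (degrees at least 0). The part in
  degrees at most \<open>p\<close> (at least \<open>p\<close>) is the shift of \<open>L\<close> (of \<open>G\<close>) by \<open>- p\<close>.
\<close>

definition bounded_t_structure ::
    "('o, 'a, 'z) triangulated_category_scheme \<Rightarrow> 'o set \<Rightarrow> 'o set \<Rightarrow> bool"
  where "bounded_t_structure C L G \<longleftrightarrow>
    subcategory C L \<and> subcategory C G \<and>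
    shift_set C 1 L \<subseteq> L \<and> shift_set C (- 1) G \<subseteq> G \<and>
    Hom_vanish C L (shift_set C (- 1) G) \<and>
    Obj C = star C L (shift_set C (- 1) G) \<and>
    (\<forall>X \<in> Obj C. \<exists>n > 0. shift C n X \<in> L \<and> shift C (- n) X \<in> G)"

definition t_interval ::
    "('o, 'a, 'z) triangulated_category_scheme \<Rightarrow> 'o set \<Rightarrow> 'o set \<Rightarrow> int \<Rightarrow> int \<Rightarrow> 'o set"
  where "t_interval C L G p q = shift_set C (- p) G \<inter> shift_set C (- q) L"

definition extended_heart ::
    "('o, 'a, 'z) triangulated_category_scheme \<Rightarrow> 'o set \<Rightarrow> 'o set \<Rightarrow> nat \<Rightarrow> 'o set"
  where "extended_heart C L G m = t_interval C L G (- (int m - 1)) 0"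

definition torsion_pair ::
    "('o, 'a, 'z) triangulated_category_scheme \<Rightarrow> 'o set \<Rightarrow> 'o set \<Rightarrow> nat \<Rightarrow> 'o set \<Rightarrow> 'o set \<Rightarrow> bool"
  where "torsion_pair C L G m T F \<longleftrightarrow>
    subcategory C T \<and> subcategory C F \<and>
    T \<subseteq> extended_heart C L G m \<and> F \<subseteq> extended_heart C L G m \<and>
    Hom_vanish C T F \<and> extended_heart C L G m = star C T F"

definition s_torsion_pair ::
    "('o, 'a, 'z) triangulated_category_scheme \<Rightarrow> 'o set \<Rightarrow> 'o set \<Rightarrow> nat \<Rightarrow> 'o set \<Rightarrow> 'o set \<Rightarrow> bool"
  where "s_torsion_pair C L G m T F \<longleftrightarrow>
    torsion_pair C L G m T F \<and> Hom_vanish C T (shift_set C (- 1) F)"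

definition Fac ::
    "('o, 'a, 'z) triangulated_category_scheme \<Rightarrow> 'o set \<Rightarrow> 'o set \<Rightarrow> nat \<Rightarrow> 'o set \<Rightarrow> 'o set"
  where "Fac C L G m A = {Z \<in> extended_heart C L G m. \<exists>Zs Xs :: nat \<Rightarrow> 'o. Zs 0 = Z \<and>
    (\<forall>i \<in> {1..m}. Zs i \<in> extended_heart C L G m \<and> Xs i \<in> A \<and>
       ex_triangle C (Zs i) (Xs i) (Zs (i - 1)))}"

definition Sub ::
    "('o, 'a, 'z) triangulated_category_scheme \<Rightarrow> 'o set \<Rightarrow> 'o set \<Rightarrow> nat \<Rightarrow> 'o set \<Rightarrow> 'o set"
  where "Sub C L G m A = {Z \<in> extended_heart C L G m. \<exists>Zs Xs :: nat \<Rightarrow> 'o. Zs 0 = Z \<and>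
    (\<forall>i \<in> {1..m}. Zs i \<in> extended_heart C L G m \<and> Xs i \<in> A \<and>
       ex_triangle C (Zs (i - 1)) (Xs i) (Zs i))}"

end

theory Submission
  imports Defs
begin

text \<open>
  Write \<open>H\<close> for the extended heart, \<open>a = - (m - 1)\<close> for its lowest degree and
  \<open>0\<close> for its highest one.

  The bridge between the two conditions is the truncation of a suspension. For \<open>X\<close> in
  \<open>T\<close> cut off the lowest cohomology: there is a triangle \<open>A \<rightarrow> X \<rightarrow> B\<close> with \<open>A\<close>
  concentrated in degree \<open>a\<close> and \<open>B\<close> in degrees above \<open>a\<close>. Then \<open>B[1]\<close> lies in
  \<open>H\<close> again, and since \<open>A[1]\<close> lies in degrees below \<open>a\<close>, \<open>Hom(X[1], Y)\<close> vanishes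
  for an object \<open>Y\<close> of degrees at least \<open>a\<close> exactly when \<open>Hom(B[1], Y)\<close> does
  (lemma \<open>suspension_truncation\<close>).

  Suppose that \<open>T\<close> is closed under \<open>m\<close>-factors. The triangles
  \<open>B \<rightarrow> 0 \<rightarrow> B[1]\<close>, \<open>A \<rightarrow> X \<rightarrow> B\<close>, \<open>A[-1] \<rightarrow> 0 \<rightarrow> A\<close>,
  \<open>A[-2] \<rightarrow> 0 \<rightarrow> A[-1]\<close>, \<open>\<dots>\<close> exhibit \<open>B[1]\<close> as an \<open>m\<close>-factor of
  \<open>T\<close>: with \<open>m\<close> triangles the shifts of \<open>A\<close> climb from degree \<open>a\<close> without
  leaving \<open>H\<close>. So \<open>B[1]\<close> is in \<open>T\<close>, it has no maps to \<open>F\<close>, and therefore \<open>X\<close>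
  has no maps to \<open>F[-1]\<close>.

  Suppose that \<open>(T, F)\<close> is an \<open>s\<close>-torsion pair. Then \<open>T\<close> is the whole left
  orthogonal of \<open>F\<close> in \<open>H\<close> (\<open>mem_T\<close>), so again \<open>B[1]\<close> is in \<open>T\<close>, and
  comparing \<open>Hom(X, F[-j-1])\<close> with \<open>Hom(B[1], F[-j])\<close> shows inductively that
  \<open>Hom(T, F[-j]) = 0\<close> for all \<open>j \<ge> 0\<close> (\<open>strong_orth_all\<close>). Dimension shifting
  along the triangles of an \<open>m\<close>-factor \<open>Z\<close> reduces \<open>Hom(Z, F) = 0\<close> to
  \<open>Hom(Z\<^sub>m, F[-m]) = 0\<close>, which holds for degree reasons; hence \<open>Z\<close> is in \<open>T\<close>.

  The statement on \<open>m\<close>-subobjects is the dual one. Besides the shift, the argument above uses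
  only which triples of objects form triangles, which Hom groups vanish and which objects are
  isomorphic. It is therefore carried out for an axiomatization of these relations that is
  visibly self-dual; this gives the second equivalence from the first without constructing the
  opposite triangulated category.
\<close>

section \<open>The calculus of triangles and vanishing Hom groups\<close>

text \<open>
  The relations \<open>tri X Y Z\<close> (there is a triangle \<open>X \<rightarrow> Y \<rightarrow> Z \<rightarrow> X[1]\<close>) and
  \<open>orth X Y\<close> (the group \<open>Hom(X, Y)\<close> vanishes) on objects. A zero object is an object
  orthogonal to itself. The axioms come in pairs that are exchanged by reversing triangles,
  swapping the arguments of \<open>orth\<close> and replacing the shift by its inverse.
\<close>

locale triangle_calculus =
  fixes Ob :: "'o set"
    and S :: "int \<Rightarrow> 'o \<Rightarrow> 'o"
    and tri :: "'o \<Rightarrow> 'o \<Rightarrow> 'o \<Rightarrow> bool"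
    and orth :: "'o \<Rightarrow> 'o \<Rightarrow> bool"
    and iso :: "'o \<Rightarrow> 'o \<Rightarrow> bool"
  assumes S_Ob [simp]: "X \<in> Ob \<Longrightarrow> S n X \<in> Ob"
    and S_zero [simp]: "X \<in> Ob \<Longrightarrow> S 0 X = X"
    and S_S [simp]: "X \<in> Ob \<Longrightarrow> S i (S j X) = S (i + j) X"
    and orth_S: "\<lbrakk>X \<in> Ob; Y \<in> Ob\<rbrakk> \<Longrightarrow> orth (S n X) (S n Y) \<longleftrightarrow> orth X Y"
    and tri_Ob: "tri X Y Z \<Longrightarrow> X \<in> Ob \<and> Y \<in> Ob \<and> Z \<in> Ob"
    and tri_rotate: "tri X Y Z \<Longrightarrow> tri Y Z (S 1 X)"
    and tri_rotate_back: "tri X Y Z \<Longrightarrow> tri (S (- 1) Z) X Y"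
    and orth_middle_left: "\<lbrakk>tri X Y Z; W \<in> Ob; orth X W; orth Z W\<rbrakk> \<Longrightarrow> orth Y W"
    and orth_middle_right: "\<lbrakk>tri X Y Z; W \<in> Ob; orth W X; orth W Z\<rbrakk> \<Longrightarrow> orth W Y"
    and iso_left: "\<lbrakk>tri X Y Z; orth Z Z\<rbrakk> \<Longrightarrow> iso X Y"
    and iso_right: "\<lbrakk>tri X Y Z; orth X X\<rbrakk> \<Longrightarrow> iso Z Y"
    and tri_zero: "\<lbrakk>X \<in> Ob; N \<in> Ob; orth N N\<rbrakk> \<Longrightarrow> tri X N (S 1 X)"
begin

lemma triangle_calculus_dual:
  "triangle_calculus Ob (\<lambda>n. S (- n)) (\<lambda>X Y Z. tri Z Y X) (\<lambda>X Y. orth Y X) iso"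
proof
  show "tri Z Y X \<Longrightarrow> tri (S (- 1) X) Z Y" for X Y Z
    by (rule tri_rotate_back)
  show "tri Z Y X \<Longrightarrow> tri Y X (S (- (- 1)) Z)" for X Y Z
    by (simp add: tri_rotate)
  show "X \<in> Ob \<Longrightarrow> N \<in> Ob \<Longrightarrow> orth N N \<Longrightarrow> tri (S (- 1) X) N X" for X N
    using tri_zero[of "S (- 1) X" N] by simp
qed (auto simp: orth_S tri_Ob intro: orth_middle_left orth_middle_right iso_left iso_right)

lemma tri_shift: "tri X Y Z \<Longrightarrow> tri (S n X) (S n Y) (S n Z)"
proof (induction n rule: int_induct[where k = 0])
  case base
  then show ?case using tri_Ob by simp
next
  case (step1 i)
  then have "tri (S 1 (S i X)) (S 1 (S i Y)) (S 1 (S i Z))"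
    by (intro tri_rotate)
  then show ?case using tri_Ob[OF step1.prems] by (simp add: add.commute)
next
  case (step2 i)
  then have "tri (S (- 1) (S i X)) (S (- 1) (S i Y)) (S (- 1) (S i Z))"
    by (intro tri_rotate_back)
  then show ?case using tri_Ob[OF step2.prems] by simp
qed

lemma orth_shift_left: "\<lbrakk>X \<in> Ob; Y \<in> Ob\<rbrakk> \<Longrightarrow> orth (S n X) Y \<longleftrightarrow> orth X (S (- n) Y)"
  using orth_S[of "S n X" Y "- n"] by simp

text \<open>
  The two orthogonality assumptions make every map from an end of the rotated triangle
  \<open>Y \<rightarrow> Z \<rightarrow> X[1]\<close> to \<open>Z\<close> vanish, so that \<open>Z\<close> is a zero object.
\<close>

lemma iso_if_orth_third:
  assumes "tri X Y Z" "orth Y Z" "orth (S 1 X) Z"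
  shows "iso X Y"
proof -
  have "orth Z Z"
    using orth_middle_left[OF tri_rotate[OF assms(1)]] tri_Ob[OF assms(1)] assms(2,3) by blast
  then show ?thesis
    by (rule iso_left[OF assms(1)])
qed

end


section \<open>t-structures\<close>

text \<open>
  The orthogonality and truncation axioms look asymmetric, since the shift is put on the
  coaisle \<open>G\<close>; shifting them by one degree shows that they are self-dual.
\<close>

locale t_structure = triangle_calculus Ob S tri orth iso
  for Ob :: "'o set" and S tri orth iso +
  fixes L G :: "'o set"
  assumes L_Ob: "L \<subseteq> Ob"
    and G_Ob: "G \<subseteq> Ob"
    and L_iso: "\<lbrakk>X \<in> L; Y \<in> Ob; iso X Y\<rbrakk> \<Longrightarrow> Y \<in> L"
    and G_iso: "\<lbrakk>X \<in> G; Y \<in> Ob; iso X Y\<rbrakk> \<Longrightarrow> Y \<in> G"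
    and L_shift: "X \<in> L \<Longrightarrow> S 1 X \<in> L"
    and G_shift: "X \<in> G \<Longrightarrow> S (- 1) X \<in> G"
    and orth_L_G: "\<lbrakk>X \<in> L; Y \<in> G\<rbrakk> \<Longrightarrow> orth X (S (- 1) Y)"
    and ex_truncation: "X \<in> Ob \<Longrightarrow> \<exists>A \<in> L. \<exists>B \<in> G. tri A X (S (- 1) B)"
begin

lemma t_structure_dual:
  "t_structure Ob (\<lambda>n. S (- n)) (\<lambda>X Y Z. tri Z Y X) (\<lambda>X Y. orth Y X) iso G L"
proof (intro t_structure.intro triangle_calculus_dual t_structure_axioms.intro)
  show "orth (S (- (- 1)) Y) X" if "X \<in> G" "Y \<in> L" for X Y
    using that orth_L_G[of Y X] orth_shift_left[of Y X 1] L_Ob G_Ob by auto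
  show "\<exists>A \<in> G. \<exists>B \<in> L. tri (S (- (- 1)) B) X A" if X: "X \<in> Ob" for X
  proof -
    obtain A B where AB: "A \<in> L" "B \<in> G" "tri A (S (- 1) X) (S (- 1) B)"
      using ex_truncation[of "S (- 1) X"] X by auto
    have "tri (S 1 A) X B"
      using tri_shift[OF AB(3), of 1] X AB(2) G_Ob by auto
    with AB show ?thesis by auto
  qed
qed (use L_Ob G_Ob L_iso G_iso L_shift G_shift in auto)

definition le :: "int \<Rightarrow> 'o set"
  where "le n = {X \<in> Ob. S n X \<in> L}"

definition ge :: "int \<Rightarrow> 'o set"
  where "ge n = {X \<in> Ob. S n X \<in> G}"

lemma le_Ob: "X \<in> le n \<Longrightarrow> X \<in> Ob" and ge_Ob: "X \<in> ge n \<Longrightarrow> X \<in> Ob"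
  by (auto simp: le_def ge_def)

lemma le_shift: "X \<in> le n \<Longrightarrow> S k X \<in> le (n - k)"
  by (simp add: le_def)

lemma ge_shift: "X \<in> ge n \<Longrightarrow> S k X \<in> ge (n - k)"
  by (simp add: ge_def)

lemma le_mono:
  assumes "X \<in> le i" "i \<le> j"
  shows "X \<in> le j"
  using assms(2)
proof (induction j rule: int_ge_induct)
  case (step j)
  then show ?case
    using L_shift[of "S j X"] by (simp add: le_def add.commute)
qed (rule assms(1))

lemma orth_le_ge:
  assumes "X \<in> le i" "Y \<in> ge j" "i < j"
  shows "orth X Y"
proof -
  have "X \<in> le (j - 1)"
    using assms by (auto intro: le_mono)
  then have "S (j - 1) X \<in> L" "S j Y \<in> G" "X \<in> Ob" "Y \<in> Ob"
    using assms(2) by (auto simp: le_def ge_def)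
  then show ?thesis
    using orth_L_G[of "S (j - 1) X" "S j Y"] orth_S[of X Y "j - 1"] by simp
qed

lemma truncation:
  assumes "X \<in> Ob"
  obtains A B where "A \<in> le n" "B \<in> ge (n + 1)" "tri A X B"
proof -
  obtain A B where AB: "A \<in> L" "B \<in> G" "tri A (S n X) (S (- 1) B)"
    using ex_truncation[of "S n X"] assms by auto
  have "tri (S (- n) A) X (S (- n - 1) B)"
    using tri_shift[OF AB(3), of "- n"] assms AB(2) G_Ob by auto
  with AB L_Ob G_Ob show ?thesis
    by (intro that[of "S (- n) A" "S (- n - 1) B"]) (auto simp: le_def ge_def)
qed

text \<open>
  Truncate \<open>X\<close>: if \<open>X\<close> has no maps to the upper part, that part is zero and
  \<open>X\<close> is isomorphic to its lower part. Extension closure of \<open>le n\<close> follows because it is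
  an orthogonal class.
\<close>

lemma mem_le:
  assumes "X \<in> Ob" "\<And>Y. Y \<in> ge (n + 1) \<Longrightarrow> orth X Y"
  shows "X \<in> le n"
proof -
  have X: "S n X \<in> Ob" using assms(1) by simp
  obtain A B where AB: "A \<in> le 0" "B \<in> ge 1" "tri A (S n X) B"
    using truncation[OF X, of 0] by auto
  have "S (- n) B \<in> ge (n + 1)"
    using ge_shift[OF AB(2), of "- n"] by (simp add: add.commute)
  then have "orth (S n X) B"
    using assms orth_shift_left AB(2) ge_Ob by blast
  moreover have "orth (S 1 A) B"
    using orth_le_ge[OF le_shift[OF AB(1)] AB(2), of 1] by simp
  ultimately have "iso A (S n X)"
    using iso_if_orth_third AB(3) by blast
  then show ?thesis
    using AB(1) L_iso[of A "S n X"] X assms(1) by (auto simp: le_def)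
qed

lemma le_extension:
  assumes "tri X Y Z" "X \<in> le n" "Z \<in> le n"
  shows "Y \<in> le n"
  using assms tri_Ob[OF assms(1)]
  by (auto intro!: mem_le orth_middle_left[OF assms(1)] intro: orth_le_ge[where i = n] ge_Ob)

text \<open>
  Reversing arrows negates degrees; the dual t-structure thus gives the properties of
  \<open>ge\<close> from those of \<open>le\<close>.
\<close>

lemma le_dual: "t_structure.le Ob (\<lambda>n. S (- n)) G n = ge (- n)"
  and ge_dual: "t_structure.ge Ob (\<lambda>n. S (- n)) L n = le (- n)"
  by (simp_all add: t_structure.le_def[OF t_structure_dual] t_structure.ge_def[OF t_structure_dual]
      le_def ge_def)

lemma ge_mono: "\<lbrakk>X \<in> ge i; j \<le> i\<rbrakk> \<Longrightarrow> X \<in> ge j"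
  using t_structure.le_mono[OF t_structure_dual, of X "- i" "- j"] by (simp add: le_dual)

lemma ge_extension: "\<lbrakk>tri X Y Z; X \<in> ge n; Z \<in> ge n\<rbrakk> \<Longrightarrow> Y \<in> ge n"
  using t_structure.le_extension[OF t_structure_dual, of X Y Z "- n"] by (simp add: le_dual)

definition interval :: "int \<Rightarrow> int \<Rightarrow> 'o set"
  where "interval a b = ge a \<inter> le b"

lemma interval_dual: "t_structure.interval Ob (\<lambda>n. S (- n)) G L (- b) (- a) = interval a b"
  by (auto simp: t_structure.interval_def[OF t_structure_dual] interval_def le_dual ge_dual)

text \<open>
  The bounds that truncation alone does not give come from the rotated triangles
  \<open>X \<rightarrow> B \<rightarrow> A[1]\<close> and \<open>B[-1] \<rightarrow> A \<rightarrow> X\<close> by extension closure.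
\<close>

lemma lowest_truncation:
  assumes "X \<in> interval a b" "a \<le> b"
  obtains A B where "tri A X B" "A \<in> interval a a" "B \<in> interval (a + 1) b"
proof -
  have X: "X \<in> ge a" "X \<in> le b"
    using assms by (auto simp: interval_def)
  obtain A B where AB: "A \<in> le a" "B \<in> ge (a + 1)" "tri A X B"
    using truncation ge_Ob X(1) by blast
  have "B \<in> le b"
    using le_extension[OF tri_rotate[OF AB(3)] X(2)] le_mono[OF le_shift[OF AB(1), of 1]] assms(2)
    by simp
  moreover have "A \<in> ge a"
    using ge_extension[OF tri_rotate_back[OF AB(3)] _ X(1)]
      ge_mono[OF ge_shift[OF AB(2), of "- 1"], of a] by simp
  ultimately show ?thesis
    using that AB by (auto simp: interval_def)
qed

end


section \<open>Torsion pairs and factors\<close>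

text \<open>
  The relation \<open>tri\<close> is a parameter so that the same definition, applied to the reversed
  triangles, yields subobjects. Recursion on the number of triangles replaces the sequences of
  objects, whose equivalence is \<open>factors_eq_sequences\<close>.
\<close>

primrec factors :: "('o \<Rightarrow> 'o \<Rightarrow> 'o \<Rightarrow> bool) \<Rightarrow> 'o set \<Rightarrow> 'o set \<Rightarrow> nat \<Rightarrow> 'o set"
  where
    "factors tri H A 0 = H"
  | "factors tri H A (Suc k) = {Z \<in> H. \<exists>X \<in> A. \<exists>Z' \<in> factors tri H A k. tri Z' X Z}"

lemma factors_subset: "factors tri H A k \<subseteq> H"
  by (cases k) auto

lemma factors_eq_sequences:
  "factors tri H A k = {Z \<in> H. \<exists>Zs Xs :: nat \<Rightarrow> 'o. Zs 0 = Z \<and>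
    (\<forall>i \<in> {1..k}. Zs i \<in> H \<and> Xs i \<in> A \<and> tri (Zs i) (Xs i) (Zs (i - 1)))}"
proof (induction k)
  case 0
  then show ?case by auto
next
  case (Suc k)
  show ?case (is "?F = ?R")
  proof (intro equalityI subsetI)
    fix Z assume "Z \<in> ?F"
    then obtain X Z' where Z: "Z \<in> H" "X \<in> A" "tri Z' X Z" and Z': "Z' \<in> factors tri H A k"
      by auto
    from Z' Suc.IH obtain Zs Xs where s: "Z' \<in> H" "Zs 0 = Z'"
      "\<forall>i \<in> {1..k}. Zs i \<in> H \<and> Xs i \<in> A \<and> tri (Zs i) (Xs i) (Zs (i - 1))"
      by auto
    define Zs' where "Zs' = case_nat Z Zs"
    \<comment> \<open>The value of \<open>Xs'\<close> at \<open>0\<close> is arbitrary: the terms start at index \<open>1\<close>.\<close>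
    define Xs' where "Xs' = case_nat X (case_nat X (\<lambda>i. Xs (Suc i)))"
    have "Zs' i \<in> H \<and> Xs' i \<in> A \<and> tri (Zs' i) (Xs' i) (Zs' (i - 1))" if i: "i \<in> {1..Suc k}" for i
    proof -
      from i obtain j where j: "i = Suc j" "j \<le> k" by (cases i) auto
      show ?thesis
        using Z s(1,2) j bspec[OF s(3), of j] by (cases j) (auto simp: Zs'_def Xs'_def)
    qed
    moreover have "Zs' 0 = Z" by (simp add: Zs'_def)
    ultimately show "Z \<in> ?R" using Z(1) by blast
  next
    fix Z assume "Z \<in> ?R"
    then obtain Zs Xs where s: "Z \<in> H" "Zs 0 = Z"
      "\<forall>i \<in> {1..Suc k}. Zs i \<in> H \<and> Xs i \<in> A \<and> tri (Zs i) (Xs i) (Zs (i - 1))"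
      by auto
    have first: "Zs 1 \<in> H" "Xs 1 \<in> A" "tri (Zs 1) (Xs 1) Z"
      using s(2) bspec[OF s(3), of 1] by auto
    have "Zs (Suc i) \<in> H \<and> Xs (Suc i) \<in> A \<and>
        tri (Zs (Suc i)) (Xs (Suc i)) (Zs (Suc (i - 1)))" if "i \<in> {1..k}" for i
      using bspec[OF s(3), of "Suc i"] that by simp
    with first(1) have "Zs 1 \<in> factors tri H A k"
      unfolding Suc.IH
      by (intro CollectI conjI exI[of _ "\<lambda>i. Zs (Suc i)"] exI[of _ "\<lambda>i. Xs (Suc i)"]) auto
    with s(1) first show "Z \<in> ?F" by auto
  qed
qed

text \<open>
  The interval \<open>[a, b]\<close> has \<open>m\<close> degrees. General bounds are needed for duality, which
  turns \<open>[a, b]\<close> into \<open>[- b, - a]\<close>.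
\<close>

locale interval_torsion_pair = t_structure Ob S tri orth iso L G
  for Ob :: "'o set" and S tri orth iso L G +
  fixes T F :: "'o set" and a b :: int and m :: nat
  assumes length: "a + int m = b + 1"
    and nonempty: "a \<le> b"
    and T_interval: "T \<subseteq> interval a b"
    and F_interval: "F \<subseteq> interval a b"
    and T_iso: "\<lbrakk>X \<in> T; Y \<in> Ob; iso X Y\<rbrakk> \<Longrightarrow> Y \<in> T"
    and F_iso: "\<lbrakk>X \<in> F; Y \<in> Ob; iso X Y\<rbrakk> \<Longrightarrow> Y \<in> F"
    and T_zero: "\<exists>N \<in> T. orth N N"
    and F_zero: "\<exists>N \<in> F. orth N N"
    and orth_T_F: "\<lbrakk>X \<in> T; Y \<in> F\<rbrakk> \<Longrightarrow> orth X Y"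
    and decompose: "Z \<in> interval a b \<Longrightarrow> \<exists>X \<in> T. \<exists>Y \<in> F. tri X Z Y"
begin

lemma interval_torsion_pair_dual:
  "interval_torsion_pair Ob (\<lambda>n. S (- n)) (\<lambda>X Y Z. tri Z Y X) (\<lambda>X Y. orth Y X) iso G L F T (- b) (- a) m"
  using length nonempty T_interval F_interval T_iso F_iso T_zero F_zero orth_T_F decompose
  by (intro interval_torsion_pair.intro t_structure_dual interval_torsion_pair_axioms.intro)
     (auto simp: interval_dual, blast)

lemma T_D: "X \<in> T \<Longrightarrow> X \<in> Ob \<and> X \<in> ge a \<and> X \<in> le b"
  and F_D: "X \<in> F \<Longrightarrow> X \<in> Ob \<and> X \<in> ge a \<and> X \<in> le b"
  using T_interval F_interval by (auto simp: interval_def le_Ob)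

text \<open>
  The condition that makes a torsion pair an \<open>s\<close>-torsion pair.
\<close>

definition strong :: bool
  where "strong \<longleftrightarrow> (\<forall>X \<in> T. \<forall>Y \<in> F. orth X (S (- 1) Y))"

text \<open>
  In the torsion triangle \<open>X \<rightarrow> Z \<rightarrow> Y\<close> the object \<open>Y\<close> receives no maps from
  \<open>Z\<close> by assumption and none from \<open>X[1]\<close> by strength, so it is zero. Strength rules
  out that \<open>Y[-1]\<close> splits off \<open>X\<close> as a nonzero summand.
\<close>

lemma mem_T:
  assumes strong "Z \<in> interval a b" "\<And>Y. Y \<in> F \<Longrightarrow> orth Z Y"
  shows "Z \<in> T"
proof -
  obtain X Y where XY: "X \<in> T" "Y \<in> F" "tri X Z Y"
    using decompose assms(2) by blast
  have "orth (S 1 X) Y"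
    using XY assms(1) orth_shift_left T_D F_D by (auto simp: strong_def)
  then have "iso X Z"
    using iso_if_orth_third XY assms(3) by blast
  then show ?thesis
    using T_iso XY tri_Ob by blast
qed

text \<open>
  \<open>S 1 B\<close> is the truncation of \<open>X[1]\<close> to degrees at least \<open>a\<close>. The part cut off and
  its suspension lie below degree \<open>a\<close>, whence the last property.
\<close>

lemma suspension_truncation:
  assumes "X \<in> T"
  obtains A B where "tri A X B" "A \<in> interval a a" "B \<in> interval a b" "S 1 B \<in> interval a b"
    "\<And>Y. Y \<in> ge a \<Longrightarrow> orth (S 1 B) Y \<longleftrightarrow> orth X (S (- 1) Y)"
proof -
  obtain A B where AB: "tri A X B" "A \<in> interval a a" "B \<in> interval (a + 1) b"
    using lowest_truncation assms T_interval nonempty by blast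
  note Ob = tri_Ob[OF AB(1)]
  have A: "A \<in> le a" and B: "B \<in> ge (a + 1)" "B \<in> le b"
    using AB by (auto simp: interval_def)
  have "orth (S 1 B) Y \<longleftrightarrow> orth X (S (- 1) Y)" if Y: "Y \<in> ge a" for Y
  proof -
    have Y': "Y \<in> Ob" using Y ge_Ob by blast
    have t: "tri (S 1 A) (S 1 X) (S 1 B)" by (rule tri_shift[OF AB(1)])
    have "orth (S 1 A) Y"
      using orth_le_ge[OF le_shift[OF A, of 1] Y] by simp
    moreover have "orth (S 1 (S 1 A)) Y"
      using orth_le_ge[OF le_shift[OF le_shift[OF A, of 1], of 1] Y] by simp
    ultimately have "orth (S 1 B) Y \<longleftrightarrow> orth (S 1 X) Y"
      using orth_middle_left[OF t Y'] orth_middle_left[OF tri_rotate[OF t] Y'] by blast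
    then show ?thesis using orth_shift_left Ob Y' by simp
  qed
  moreover have "S 1 B \<in> interval a b" "B \<in> interval a b"
    using ge_shift[OF B(1), of 1] le_mono[OF le_shift[OF B(2), of 1]] B(2) ge_mono[OF B(1)]
    by (auto simp: interval_def)
  ultimately show ?thesis using that AB by blast
qed

text \<open>
  One shift of \<open>Y\<close> is traded for replacing \<open>X\<close> by the truncation of its suspension, which
  is again in \<open>T\<close>.
\<close>

lemma strong_orth_all:
  assumes strong "X \<in> T" "Y \<in> F"
  shows "orth X (S (- int j) Y)"
  using assms(2)
proof (induction j arbitrary: X)
  case 0
  then show ?case using orth_T_F assms(3) F_D by simp
next
  case (Suc j)
  obtain B where B: "S 1 B \<in> interval a b"
    "\<And>Y. Y \<in> ge a \<Longrightarrow> orth (S 1 B) Y \<longleftrightarrow> orth X (S (- 1) Y)"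
    using suspension_truncation Suc.prems by metis
  have "S 1 B \<in> T"
    using assms(1) Suc.prems B F_D by (intro mem_T) (auto simp: strong_def)
  then have "orth (S 1 B) (S (- int j) Y)"
    by (rule Suc.IH)
  moreover have "S (- int j) Y \<in> ge a"
    using ge_mono[OF ge_shift[of Y a "- int j"]] F_D assms(3) by simp
  ultimately have "orth X (S (- 1) (S (- int j) Y))"
    using B(2) by blast
  then show ?case using F_D assms(3) by simp
qed

text \<open>
  Dimension shifting along \<open>X \<rightarrow> Z \<rightarrow> Z'[1]\<close>: each remaining triangle costs one shift of
  \<open>Y\<close>. When no triangle remains, \<open>Y\<close> has been shifted \<open>m\<close> times, out of the range of
  degrees of \<open>Z\<close>.
\<close>

lemma strong_factors_orth:
  assumes strong "Y \<in> F" "Z \<in> factors tri (interval a b) T k" "j + k = m"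
  shows "orth Z (S (- int j) Y)"
  using assms(3,4)
proof (induction k arbitrary: Z j)
  case 0
  have "S (- int m) Y \<in> ge (b + 1)"
    using ge_shift[of Y a "- int m"] F_D[OF assms(2)] length by simp
  then show ?case
    using 0 orth_le_ge[of Z b _ "b + 1"] by (simp add: interval_def)
next
  case (Suc k)
  then obtain X Z' where Z: "X \<in> T" "tri Z' X Z" "Z' \<in> factors tri (interval a b) T k"
    by auto
  note Ob = tri_Ob[OF Z(2)] F_D[OF assms(2)]
  have "orth Z' (S (- int (Suc j)) Y)"
    using Suc.IH[OF Z(3), of "Suc j"] Suc.prems(2) by simp
  then have "orth (S 1 Z') (S (- int j) Y)"
    using Ob by (simp add: orth_shift_left)
  moreover have "orth X (S (- int j) Y)"
    by (rule strong_orth_all[OF assms(1) Z(1) assms(2)])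
  ultimately show ?case
    using orth_middle_left[OF tri_rotate[OF Z(2)]] Ob by simp
qed

text \<open>
  The triangles \<open>A[-1] \<rightarrow> 0 \<rightarrow> A\<close> raise the degree by one each, so an object of degree
  \<open>i\<close> admits \<open>b - i\<close> of them inside the interval.
\<close>

lemma lowest_factors:
  assumes "i + int k \<le> b" "a \<le> i" "A \<in> interval i i"
  shows "A \<in> factors tri (interval a b) T k"
  using assms
proof (induction k arbitrary: A i)
  case 0
  then show ?case by (auto simp: interval_def intro: ge_mono le_mono)
next
  case (Suc k)
  have "S (- 1) A \<in> interval (i + 1) (i + 1)"
    using Suc.prems(3) le_shift[of A i "- 1"] ge_shift[of A i "- 1"] by (simp add: interval_def)
  then have "S (- 1) A \<in> factors tri (interval a b) T k"
    using Suc.IH[of "i + 1"] Suc.prems by simp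
  moreover obtain N where N: "N \<in> T" "orth N N"
    using T_zero by blast
  moreover have "A \<in> Ob"
    using Suc.prems(3) le_Ob by (auto simp: interval_def)
  then have "tri (S (- 1) A) N A"
    using tri_zero[of "S (- 1) A" N] N T_D by simp
  moreover have "A \<in> interval a b"
    using Suc.prems by (auto simp: interval_def intro: ge_mono le_mono)
  ultimately show ?case by auto
qed

theorem strong_iff_factors_subset:
  "strong \<longleftrightarrow> factors tri (interval a b) T m \<subseteq> T"
proof
  assume s: strong
  show "factors tri (interval a b) T m \<subseteq> T"
  proof
    fix Z assume Z: "Z \<in> factors tri (interval a b) T m"
    have "orth Z Y" if "Y \<in> F" for Y
      using strong_factors_orth[OF s that Z, of 0] F_D that by simp
    then show "Z \<in> T"
      using mem_T[OF s] Z subsetD[OF factors_subset Z] by simp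
  qed
next
  assume closed: "factors tri (interval a b) T m \<subseteq> T"
  show strong
    unfolding strong_def
  proof (intro ballI)
    fix X Y assume X: "X \<in> T" and Y: "Y \<in> F"
    obtain A B where AB: "tri A X B" "A \<in> interval a a" "B \<in> interval a b" "S 1 B \<in> interval a b"
      "\<And>Y. Y \<in> ge a \<Longrightarrow> orth (S 1 B) Y \<longleftrightarrow> orth X (S (- 1) Y)"
      using suspension_truncation[OF X] by metis
    obtain N where N: "N \<in> T" "orth N N"
      using T_zero by blast
    have tB: "tri B N (S 1 B)"
      using tri_zero N T_D tri_Ob[OF AB(1)] by blast
    obtain n where n: "m = Suc n"
      using length nonempty by (cases m) auto
    \<comment> \<open>Two triangles lead from \<open>B[1]\<close> down to \<open>A\<close>, and the remaining \<open>m - 2\<close> fit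
      because \<open>A\<close> is in the lowest degree \<open>a\<close>. For \<open>m = 1\<close> only the first one is used.\<close>
    have "B \<in> factors tri (interval a b) T n"
    proof (cases n)
      case 0
      then show ?thesis using AB(3) by simp
    next
      case (Suc k)
      then have "A \<in> factors tri (interval a b) T k"
        using lowest_factors[OF _ _ AB(2)] n length by simp
      then show ?thesis using Suc AB X by auto
    qed
    then have "S 1 B \<in> factors tri (interval a b) T m"
      using n AB(4) N tB by auto
    then have "orth (S 1 B) Y"
      using closed orth_T_F Y by blast
    then show "orth X (S (- 1) Y)"
      using AB(5) F_D Y by blast
  qed
qed

theorem strong_iff_subobjects_subset:
  "strong \<longleftrightarrow> factors (\<lambda>X Y Z. tri Z Y X) (interval a b) F m \<subseteq> F"
proof -
  interpret op: interval_torsion_pair Ob "\<lambda>n. S (- n)" "\<lambda>X Y Z. tri Z Y X" "\<lambda>X Y. orth Y X"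
      iso G L F T "- b" "- a" m
    by (rule interval_torsion_pair_dual)
  have "op.strong \<longleftrightarrow> strong"
    using T_D F_D by (auto simp: op.strong_def strong_def orth_shift_left)
  then show ?thesis
    using op.strong_iff_factors_subset by (simp add: interval_dual)
qed

end


section \<open>Additive categories\<close>

definition orthogonal ::
    "('o, 'a, 'z) additive_category_scheme \<Rightarrow> 'o \<Rightarrow> 'o \<Rightarrow> bool"
  where "orthogonal C X Y \<longleftrightarrow> Hom C X Y = {Zero C X Y}"

context additive_category
begin

lemma Hom_Obj: "f \<in> Hom C X Y \<Longrightarrow> X \<in> Obj C \<and> Y \<in> Obj C"
  using Dom_Obj Cod_Obj by (auto simp: Hom_def)

lemma Zero_Hom: "\<lbrakk>X \<in> Obj C; Y \<in> Obj C\<rbrakk> \<Longrightarrow> Zero C X Y \<in> Hom C X Y"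
  using monoid.one_closed[OF group.is_monoid[OF comm_group.axioms(2)[OF hom_group]]]
  by (simp add: hom_group_def)

lemma Neg_Hom: "f \<in> Hom C X Y \<Longrightarrow> Neg C f \<in> Hom C X Y"
  using group.inv_closed[OF comm_group.axioms(2)[OF hom_group], of X Y f] Hom_Obj[of f X Y]
  by (simp add: hom_group_def Neg_def Hom_def)

lemma Neg_Neg:
  assumes "f \<in> Hom C X Y"
  shows "Neg C (Neg C f) = f"
  using group.inv_inv[OF comm_group.axioms(2)[OF hom_group], of X Y f] Hom_Obj[OF assms]
    Neg_Hom[OF assms] assms
  by (auto simp: hom_group_def Neg_def Hom_def)

text \<open>
  Additive maps send zero to an idempotent for addition; this is how \<open>Comp_Zero\<close>,
  \<open>Zero_Comp\<close> and \<open>ShA_Zero\<close> are obtained.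
\<close>

lemma eq_Zero_if_idem:
  assumes "f \<in> Hom C X Y" "Add C f f = f"
  shows "f = Zero C X Y"
  using group.r_cancel_one[OF comm_group.axioms(2)[OF hom_group], of X Y f f] Hom_Obj[OF assms(1)] assms
  by (simp add: hom_group_def)

lemma Add_Zero:
  assumes "X \<in> Obj C" "Y \<in> Obj C"
  shows "Add C (Zero C X Y) (Zero C X Y) = Zero C X Y"
  using monoid.l_one[OF group.is_monoid[OF comm_group.axioms(2)[OF hom_group]], of X Y "Zero C X Y"]
    assms Zero_Hom[OF assms]
  by (simp add: hom_group_def)

lemma Comp_Zero:
  assumes "g \<in> Hom C Y Z" "X \<in> Obj C"
  shows "g \<cdot> Zero C X Y = Zero C X Z"
proof (rule eq_Zero_if_idem)
  have Z: "Zero C X Y \<in> Hom C X Y" using assms Hom_Obj Zero_Hom by blast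
  show "g \<cdot> Zero C X Y \<in> Hom C X Z" using Comp_Hom Z assms by blast
  show "Add C (g \<cdot> Zero C X Y) (g \<cdot> Zero C X Y) = g \<cdot> Zero C X Y"
    using Comp_Add[OF Z Z assms(1)] Add_Zero Hom_Obj assms by simp
qed

lemma Zero_Comp:
  assumes "f \<in> Hom C X Y" "Z \<in> Obj C"
  shows "Zero C Y Z \<cdot> f = Zero C X Z"
proof (rule eq_Zero_if_idem)
  have Z: "Zero C Y Z \<in> Hom C Y Z" using assms Hom_Obj Zero_Hom by blast
  show "Zero C Y Z \<cdot> f \<in> Hom C X Z" using Comp_Hom Z assms by blast
  show "Add C (Zero C Y Z \<cdot> f) (Zero C Y Z \<cdot> f) = Zero C Y Z \<cdot> f"
    using Add_Comp[OF assms(1) Z Z] Add_Zero Hom_Obj assms by simp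
qed

lemma Neg_unique:
  assumes "f \<in> Hom C X Y" "g \<in> Hom C X Y" "Add C f g = Zero C X Y"
  shows "f = Neg C g"
  using group.inv_equality[OF comm_group.axioms(2)[OF hom_group], of X Y f g] Hom_Obj[OF assms(1)] assms
  by (auto simp: hom_group_def Neg_def Hom_def)

lemma Add_Neg:
  assumes "f \<in> Hom C X Y"
  shows "Add C (Neg C f) f = Zero C X Y"
  using group.l_inv[OF comm_group.axioms(2)[OF hom_group], of X Y f] Hom_Obj[OF assms] assms
  by (auto simp: hom_group_def Neg_def Hom_def)

lemma Comp_Neg:
  assumes "f \<in> Hom C X Y" "g \<in> Hom C Y Z"
  shows "g \<cdot> Neg C f = Neg C (g \<cdot> f)"
proof (rule Neg_unique)
  show "Add C (g \<cdot> Neg C f) (g \<cdot> f) = Zero C X Z"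
    using Comp_Add[OF Neg_Hom[OF assms(1)] assms] Add_Neg[OF assms(1)] Comp_Zero[OF assms(2)]
      Hom_Obj[OF assms(1)] by simp
qed (use assms Comp_Hom Neg_Hom in blast)+

lemma Neg_Comp:
  assumes "f \<in> Hom C X Y" "g \<in> Hom C Y Z"
  shows "Neg C g \<cdot> f = Neg C (g \<cdot> f)"
proof (rule Neg_unique)
  show "Add C (Neg C g \<cdot> f) (g \<cdot> f) = Zero C X Z"
    using Add_Comp[OF assms(1) Neg_Hom[OF assms(2)] assms(2)] Add_Neg[OF assms(2)]
      Zero_Comp[OF assms(1)] Hom_Obj[OF assms(2)] by simp
qed (use assms Comp_Hom Neg_Hom in blast)+

lemma orthogonalI:
  assumes "X \<in> Obj C" "Y \<in> Obj C" "\<And>f. f \<in> Hom C X Y \<Longrightarrow> f = Zero C X Y"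
  shows "orthogonal C X Y"
  using assms Zero_Hom by (auto simp: orthogonal_def)

lemma orthogonalD: "\<lbrakk>orthogonal C X Y; f \<in> Hom C X Y\<rbrakk> \<Longrightarrow> f = Zero C X Y"
  by (simp add: orthogonal_def)

lemma zero_object_iff: "zero_object C N \<longleftrightarrow> N \<in> Obj C \<and> orthogonal C N N"
proof (intro iffI conjI)
  assume N: "zero_object C N"
  then show "N \<in> Obj C" by (simp add: zero_object_def)
  then show "orthogonal C N N"
    using N Zero_Hom by (intro orthogonalI) (auto simp: zero_object_def)
next
  assume "N \<in> Obj C \<and> orthogonal C N N"
  then have N: "N \<in> Obj C" "Id C N = Zero C N N"
    using Id_Hom orthogonalD by blast+
  have "f = Zero C X N" if "f \<in> Hom C X N" for f X
    using Id_Comp[OF that] Zero_Comp[OF that N(1)] N(2) by simp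
  moreover have "f = Zero C N X" if "f \<in> Hom C N X" for f X
    using Comp_Id[OF that] Comp_Zero[OF that N(1)] N(2) by simp
  ultimately show "zero_object C N"
    using N(1) Zero_Hom unfolding zero_object_def by blast
qed

lemma zero_object_orthogonal:
  assumes "zero_object C N" "X \<in> Obj C"
  shows "orthogonal C X N" "orthogonal C N X"
  using assms Zero_Hom[of X N] Zero_Hom[of N X]
  by (auto simp: zero_object_def intro!: orthogonalI)

lemma isomorphic_sym: "isomorphic C X Y \<Longrightarrow> isomorphic C Y X"
  unfolding isomorphic_def is_iso_def by blast

lemma isomorphic_if_inverses:
  assumes f: "f \<in> Hom C X Y" and g: "g \<in> Hom C Y X" "g \<cdot> f = Id C X"
    and h: "h \<in> Hom C Y X" "f \<cdot> h = Id C Y"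
  shows "isomorphic C X Y"
proof -
  have "g = g \<cdot> (f \<cdot> h)" using h(2) Comp_Id[OF g(1)] by simp
  also have "\<dots> = h" using Comp_assoc[OF h(1) f g(1)] g(2) Id_Comp[OF h(1)] by simp
  finally have "f \<cdot> g = Id C Y" using h(2) by simp
  then show ?thesis using f g unfolding isomorphic_def is_iso_def by blast
qed

end

section \<open>Iterated shifts\<close>

context triangulated_category
begin

lemma Sh_Obj: "X \<in> Obj C \<Longrightarrow> Sh C X \<in> Obj C"
  using Sh_bij by (rule bij_betwE[THEN bspec])

lemma shift_1 [simp]: "shift C 1 X = Sh C X"
  by (simp add: shift_def)

lemma shift_0 [simp]: "shift C 0 X = X"
  by (simp add: shift_def)

lemma shift_Obj:
  assumes "X \<in> Obj C"
  shows "shift C n X \<in> Obj C"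
proof -
  have "(Sh C ^^ k) X \<in> Obj C" "(inv_into (Obj C) (Sh C) ^^ k) X \<in> Obj C" for k
    using assms Sh_Obj bij_betwE[OF bij_betw_inv_into[OF Sh_bij]] by (induction k) auto
  then show ?thesis by (simp add: shift_def)
qed

lemma shift_Suc:
  assumes "X \<in> Obj C"
  shows "shift C (n + 1) X = Sh C (shift C n X)"
proof (cases "0 \<le> n")
  case True
  then show ?thesis by (simp add: shift_def nat_add_distrib)
next
  case False
  then have n: "nat (- n) = Suc (nat (- n - 1))" by simp
  have "shift C (n + 1) X = (inv_into (Obj C) (Sh C) ^^ nat (- n - 1)) X"
    using False by (cases "n = - 1") (auto simp: shift_def)
  moreover from this have "shift C n X = inv_into (Obj C) (Sh C) (shift C (n + 1) X)"
    using False n by (simp add: shift_def)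
  ultimately show ?thesis
    using bij_betw_inv_into_right[OF Sh_bij shift_Obj[OF assms, of "n + 1"]] by simp
qed

lemma Sh_inj: "\<lbrakk>Sh C X = Sh C Y; X \<in> Obj C; Y \<in> Obj C\<rbrakk> \<Longrightarrow> X = Y"
  using inj_onD[OF bij_betw_imp_inj_on[OF Sh_bij]] by blast

lemma shift_shift:
  assumes "X \<in> Obj C"
  shows "shift C i (shift C j X) = shift C (i + j) X"
proof (induction i rule: int_induct[where k = 0])
  case (step1 i)
  then show ?case
    using shift_Suc[of "shift C j X" i] shift_Suc[OF assms, of "i + j"] shift_Obj[OF assms]
    by (simp add: algebra_simps)
next
  case (step2 i)
  have "Sh C (shift C (i - 1) (shift C j X)) = Sh C (shift C (i - 1 + j) X)"
    using step2 shift_Suc[of "shift C j X" "i - 1"] shift_Suc[OF assms, of "i - 1 + j"]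
      shift_Obj[OF assms]
    by (simp add: algebra_simps)
  then show ?case using Sh_inj shift_Obj assms by blast
qed simp

lemma shift_set_eq:
  assumes "A \<subseteq> Obj C"
  shows "shift_set C (- n) A = {X \<in> Obj C. shift C n X \<in> A}"
proof (intro equalityI subsetI)
  fix X assume "X \<in> {X \<in> Obj C. shift C n X \<in> A}"
  then show "X \<in> shift_set C (- n) A"
    using shift_shift[of X "- n" n] by (force simp: shift_set_def)
next
  fix X assume "X \<in> shift_set C (- n) A"
  then show "X \<in> {X \<in> Obj C. shift C n X \<in> A}"
    using assms shift_shift shift_Obj by (auto simp: shift_set_def)
qed

lemma ShA_Hom: "f \<in> Hom C X Y \<Longrightarrow> ShA C f \<in> Hom C (Sh C X) (Sh C Y)"
  using bij_betwE[OF ShA_bij[of X Y]] Hom_Obj[of f X Y] by blast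

lemma ShA_surj:
  assumes "X \<in> Obj C" "Y \<in> Obj C" "g \<in> Hom C (Sh C X) (Sh C Y)"
  obtains f where "f \<in> Hom C X Y" "ShA C f = g"
  using bij_betw_imp_surj_on[OF ShA_bij[OF assms(1,2)]] assms(3) that by (metis imageE)

lemma ShA_inj: "\<lbrakk>ShA C f = ShA C g; f \<in> Hom C X Y; g \<in> Hom C X Y\<rbrakk> \<Longrightarrow> f = g"
  using inj_onD[OF bij_betw_imp_inj_on[OF ShA_bij[of X Y]], of f g] Hom_Obj[of f X Y] by simp

lemma ShA_Zero:
  assumes "X \<in> Obj C" "Y \<in> Obj C"
  shows "ShA C (Zero C X Y) = Zero C (Sh C X) (Sh C Y)"
  using ShA_Add[OF Zero_Hom[OF assms] Zero_Hom[OF assms]] Add_Zero[OF assms]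
  by (intro eq_Zero_if_idem ShA_Hom Zero_Hom assms) simp

lemma orthogonal_Sh:
  assumes "X \<in> Obj C" "Y \<in> Obj C"
  shows "orthogonal C (Sh C X) (Sh C Y) \<longleftrightarrow> orthogonal C X Y"
proof
  assume "orthogonal C (Sh C X) (Sh C Y)"
  then show "orthogonal C X Y"
    using orthogonalD ShA_Hom ShA_Zero[OF assms] ShA_inj Zero_Hom[OF assms]
    by (intro orthogonalI assms) metis
next
  assume "orthogonal C X Y"
  then show "orthogonal C (Sh C X) (Sh C Y)"
    using orthogonalD ShA_surj[OF assms] ShA_Zero[OF assms]
    by (intro orthogonalI Sh_Obj assms) metis
qed

lemma orthogonal_shift:
  assumes "X \<in> Obj C" "Y \<in> Obj C"
  shows "orthogonal C (shift C n X) (shift C n Y) \<longleftrightarrow> orthogonal C X Y"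
proof (induction n rule: int_induct[where k = 0])
  case (step1 n)
  then show ?case
    using orthogonal_Sh[OF shift_Obj shift_Obj, OF assms] shift_Suc assms by simp
next
  case (step2 n)
  then show ?case
    using orthogonal_Sh[OF shift_Obj shift_Obj, OF assms, of "n - 1" "n - 1"]
      shift_Suc[of _ "n - 1"] assms by simp
qed simp


section \<open>Exactness of Hom on triangles\<close>

lemma triangle_Hom:
  assumes "triangle C X Y Z f g h"
  shows "f \<in> Hom C X Y" "g \<in> Hom C Y Z" "h \<in> Hom C Z (Sh C X)"
  using assms by (auto simp: triangle_def candidate_triangle_def)

lemma triangle_Obj: "triangle C X Y Z f g h \<Longrightarrow> X \<in> Obj C \<and> Y \<in> Obj C \<and> Z \<in> Obj C"
  using Hom_Obj[OF triangle_Hom(1)] Hom_Obj[OF triangle_Hom(2)] by blast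

lemma triangle_rotate:
  "triangle C X Y Z f g h \<Longrightarrow> triangle C Y Z (Sh C X) g h (Neg C (ShA C f))"
  using TR2[THEN iffD1] unfolding triangle_def by blast

lemma triangle_rotate_back:
  assumes "triangle C X Y Z f g h"
  obtains k where "triangle C (shift C (- 1) Z) X Y k f g"
proof -
  note H = triangle_Hom[OF assms]
  have Obj: "X \<in> Obj C" "shift C (- 1) Z \<in> Obj C" "Sh C (shift C (- 1) Z) = Z"
    using H Hom_Obj shift_Obj shift_Suc[of Z "- 1"] by auto
  obtain k where k: "k \<in> Hom C (shift C (- 1) Z) X" "ShA C k = Neg C h"
    using ShA_surj[OF Obj(2,1)] Neg_Hom[OF H(3)] Obj(3) by metis
  have "candidate_triangle C (shift C (- 1) Z) X Y k f g"
    using H k Obj by (simp add: candidate_triangle_def)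
  then have "triangle C (shift C (- 1) Z) X Y k f g"
    by (rule TR2[THEN iffD2]) (use assms k(2) Neg_Neg[OF H(3)] Obj(3) in simp)
  then show thesis by (rule that)
qed

text \<open>
  Extend \<open>u\<close> to a morphism of triangles into \<open>0[-1] \<rightarrow> W \<rightarrow> W \<rightarrow> 0\<close>.
\<close>

lemma weak_cokernel:
  assumes t: "triangle C X Y Z f g h" and u: "u \<in> Hom C Y W" "u \<cdot> f = Zero C X W"
  obtains v where "v \<in> Hom C Z W" "v \<cdot> g = u"
proof -
  obtain N where N: "zero_object C N" using ex_zero_object by blast
  have W: "W \<in> Obj C" and X: "X \<in> Obj C"
    using u(1) Hom_Obj triangle_Hom(1)[OF t] by blast+
  obtain k where k: "triangle C (shift C (- 1) N) W W k (Id C W) (Zero C W N)"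
    using triangle_rotate_back[OF TR1_id[OF W N]] .
  have N': "shift C (- 1) N \<in> Obj C"
    using N shift_Obj by (simp add: zero_object_def)
  have "u \<cdot> f = k \<cdot> Zero C X (shift C (- 1) N)"
    using u(2) Comp_Zero[OF triangle_Hom(1)[OF k] X] by simp
  then obtain v where v: "v \<in> Hom C Z W" "v \<cdot> g = Id C W \<cdot> u"
    using TR3[OF t k Zero_Hom[OF X N'] u(1)] by blast
  show thesis using that[OF v(1)] v(2) Id_Comp[OF u(1)] by simp
qed

text \<open>
  Extend \<open>(u, 0)\<close> to a morphism from \<open>W \<rightarrow> 0 \<rightarrow> W[1]\<close> to the rotated triangle
  \<open>Y \<rightarrow> Z \<rightarrow> X[1]\<close>; its third component is the shift of the desired \<open>v\<close>. Both rotated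
  triangles carry a sign in their last arrow, and the two signs cancel.
\<close>

lemma weak_kernel:
  assumes t: "triangle C X Y Z f g h" and u: "u \<in> Hom C W Y" "g \<cdot> u = Zero C W Z"
  obtains v where "v \<in> Hom C W X" "f \<cdot> v = u"
proof -
  note H = triangle_Hom[OF t]
  obtain N where N: "zero_object C N" using ex_zero_object by blast
  then have N': "N \<in> Obj C" by (simp add: zero_object_def)
  have W: "W \<in> Obj C" and X: "X \<in> Obj C" and Z: "Z \<in> Obj C"
    using u(1) Hom_Obj H by blast+
  have r: "triangle C W N (Sh C W) (Zero C W N) (Zero C N (Sh C W)) (Neg C (Id C (Sh C W)))"
    using triangle_rotate[OF TR1_id[OF W N]] ShA_Id[OF W] by simp
  have "Zero C N Z \<cdot> Zero C W N = g \<cdot> u"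
    using u(2) Comp_Zero[OF Zero_Hom[OF N' Z] W] by simp
  then obtain c where c: "c \<in> Hom C (Sh C W) (Sh C X)"
    "ShA C u \<cdot> Neg C (Id C (Sh C W)) = Neg C (ShA C f) \<cdot> c"
    using TR3[OF r triangle_rotate[OF t] u(1) Zero_Hom[OF N' Z]] by blast
  obtain v where v: "v \<in> Hom C W X" "ShA C v = c"
    using ShA_surj[OF W X c(1)] .
  have "Neg C (ShA C u) = Neg C (ShA C (f \<cdot> v))"
    using c(2) v Comp_Neg[OF Id_Hom[OF Sh_Obj[OF W]] ShA_Hom[OF u(1)]] Comp_Id[OF ShA_Hom[OF u(1)]]
      Neg_Comp[OF c(1) ShA_Hom[OF H(1)]] ShA_Comp[OF v(1) H(1)]
    by simp
  then have "ShA C u = ShA C (f \<cdot> v)"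
    using Neg_Neg[OF ShA_Hom[OF u(1)]] Neg_Neg[OF ShA_Hom[OF Comp_Hom[OF v(1) H(1)]]] by metis
  then have "u = f \<cdot> v"
    by (rule ShA_inj[OF _ u(1) Comp_Hom[OF v(1) H(1)]])
  then show thesis using that[OF v(1)] by simp
qed

text \<open>
  The identity of \<open>Y\<close> lifts along \<open>f\<close> because \<open>Z\<close> is zero, and the identity of
  \<open>X\<close> extends along \<open>f\<close> because \<open>Z[-1]\<close> is zero.
\<close>

lemma isomorphic_if_third_zero:
  assumes t: "triangle C X Y Z f g h" and Z: "orthogonal C Z Z"
  shows "isomorphic C X Y"
proof -
  note H = triangle_Hom[OF t]
  have Obj: "X \<in> Obj C" "Y \<in> Obj C" "Z \<in> Obj C"
    using H Hom_Obj by blast+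
  have "zero_object C Z" using Z Obj zero_object_iff by blast
  then have Z0: "orthogonal C Y Z"
    using zero_object_orthogonal Obj by blast
  obtain k where k: "triangle C (shift C (- 1) Z) X Y k f g"
    using triangle_rotate_back[OF t] .
  have "orthogonal C (shift C (- 1) Z) (shift C (- 1) Z)"
    using Z orthogonal_shift Obj by blast
  then have "zero_object C (shift C (- 1) Z)"
    using zero_object_iff shift_Obj Obj by blast
  then have Z1: "orthogonal C (shift C (- 1) Z) X"
    using zero_object_orthogonal Obj by blast
  have "g \<cdot> Id C Y = Zero C Y Z"
    using Z0 Comp_Hom[OF Id_Hom H(2)] Obj orthogonalD by blast
  then obtain r where r: "r \<in> Hom C Y X" "f \<cdot> r = Id C Y"
    using weak_kernel[OF t Id_Hom] Obj by blast
  have "Id C X \<cdot> k = Zero C (shift C (- 1) Z) X"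
    using Z1 Comp_Hom[OF triangle_Hom(1)[OF k] Id_Hom] Obj orthogonalD by blast
  then obtain l where l: "l \<in> Hom C Y X" "l \<cdot> f = Id C X"
    using weak_cokernel[OF k Id_Hom] Obj by blast
  show ?thesis
    by (rule isomorphic_if_inverses[OF H(1) l r])
qed

lemma triangle_calculus:
  "triangle_calculus (Obj C) (shift C) (ex_triangle C) (orthogonal C) (isomorphic C)"
proof
  show rotate: "ex_triangle C Y Z (shift C 1 X)" if "ex_triangle C X Y Z" for X Y Z
    using that triangle_rotate unfolding ex_triangle_def shift_1 by blast
  show "ex_triangle C (shift C (- 1) Z) X Y" if "ex_triangle C X Y Z" for X Y Z
    using that unfolding ex_triangle_def by (elim exE) (erule triangle_rotate_back, blast)
  show Obj: "X \<in> Obj C \<and> Y \<in> Obj C \<and> Z \<in> Obj C" if "ex_triangle C X Y Z" for X Y Z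
    using that unfolding ex_triangle_def by (elim exE) (rule triangle_Obj)
  show "orthogonal C Y W" if t: "ex_triangle C X Y Z" and W: "W \<in> Obj C"
    and o: "orthogonal C X W" "orthogonal C Z W" for X Y Z W
  proof (rule orthogonalI)
    fix u assume u: "u \<in> Hom C Y W"
    obtain f g h where fgh: "triangle C X Y Z f g h"
      using t by (auto simp: ex_triangle_def)
    note H = triangle_Hom[OF fgh]
    have "u \<cdot> f = Zero C X W"
      using o(1) Comp_Hom[OF H(1) u] orthogonalD by blast
    then obtain v where "v \<in> Hom C Z W" "v \<cdot> g = u"
      by (rule weak_cokernel[OF fgh u])
    then show "u = Zero C Y W"
      using orthogonalD[OF o(2)] Zero_Comp[OF H(2) W] by blast
  qed (use Obj[OF t] W in auto)
  show "orthogonal C W Y" if t: "ex_triangle C X Y Z" and W: "W \<in> Obj C"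
    and o: "orthogonal C W X" "orthogonal C W Z" for X Y Z W
  proof (rule orthogonalI)
    fix u assume u: "u \<in> Hom C W Y"
    obtain f g h where fgh: "triangle C X Y Z f g h"
      using t by (auto simp: ex_triangle_def)
    note H = triangle_Hom[OF fgh]
    have "g \<cdot> u = Zero C W Z"
      using o(2) Comp_Hom[OF u H(2)] orthogonalD by blast
    then obtain v where "v \<in> Hom C W X" "f \<cdot> v = u"
      by (rule weak_kernel[OF fgh u])
    then show "u = Zero C W Y"
      using orthogonalD[OF o(1)] Comp_Zero[OF H(1) W] by blast
  qed (use Obj[OF t] W in auto)
  show "isomorphic C X Y" if "ex_triangle C X Y Z" "orthogonal C Z Z" for X Y Z
    using that isomorphic_if_third_zero unfolding ex_triangle_def by blast
  show "isomorphic C Z Y" if t: "ex_triangle C X Y Z" and o: "orthogonal C X X" for X Y Z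
  proof -
    have "orthogonal C (shift C 1 X) (shift C 1 X)"
      using o orthogonal_shift Obj[OF t] by blast
    then show ?thesis
      using rotate[OF t] isomorphic_if_third_zero isomorphic_sym unfolding ex_triangle_def by blast
  qed
  show "ex_triangle C X N (shift C 1 X)" if "X \<in> Obj C" "N \<in> Obj C" "orthogonal C N N" for X N
  proof (rule rotate)
    show "ex_triangle C X X N"
      using TR1_id[OF that(1)] that zero_object_iff unfolding ex_triangle_def by blast
  qed
qed (simp_all add: shift_Obj shift_shift orthogonal_shift)


section \<open>Torsion pairs in the extended heart\<close>

lemma subcategoryD:
  assumes "subcategory C A"
  shows "A \<subseteq> Obj C" "\<lbrakk>X \<in> A; Y \<in> Obj C; isomorphic C X Y\<rbrakk> \<Longrightarrow> Y \<in> A"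
    "\<exists>N \<in> A. orthogonal C N N"
  using assms unfolding subcategory_def zero_object_iff by blast+

lemma t_structure:
  assumes "bounded_t_structure C L G"
  shows "t_structure (Obj C) (shift C) (ex_triangle C) (orthogonal C) (isomorphic C) L G"
proof (intro t_structure.intro triangle_calculus t_structure_axioms.intro)
  note t = assms[unfolded bounded_t_structure_def]
  from t have L: "subcategory C L" and G: "subcategory C G" by blast+
  show "L \<subseteq> Obj C" "G \<subseteq> Obj C"
    by (rule subcategoryD(1)[OF L], rule subcategoryD(1)[OF G])
  show "Y \<in> L" if "X \<in> L" "Y \<in> Obj C" "isomorphic C X Y" for X Y
    by (rule subcategoryD(2)[OF L that])
  show "Y \<in> G" if "X \<in> G" "Y \<in> Obj C" "isomorphic C X Y" for X Y
    by (rule subcategoryD(2)[OF G that])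
  show "orthogonal C X (shift C (- 1) Y)" if "X \<in> L" "Y \<in> G" for X Y
  proof -
    have "Hom_vanish C L (shift_set C (- 1) G)" using t by blast
    then show ?thesis using that by (auto simp: Hom_vanish_def shift_set_def orthogonal_def)
  qed
  show "\<exists>A \<in> L. \<exists>B \<in> G. ex_triangle C A X (shift C (- 1) B)" if "X \<in> Obj C" for X
  proof -
    have "X \<in> star C L (shift_set C (- 1) G)" using t that by blast
    then show ?thesis by (auto simp: star_def shift_set_def)
  qed
  show "shift C 1 X \<in> L" if "X \<in> L" for X
    using t that unfolding shift_set_def by (metis image_subset_iff)
  show "shift C (- 1) X \<in> G" if "X \<in> G" for X
    using t that unfolding shift_set_def by (metis image_subset_iff)
qed

lemma extended_heart_eq_interval:
  assumes "bounded_t_structure C L G"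
  shows "extended_heart C L G m =
    t_structure.interval (Obj C) (shift C) L G (- (int m - 1)) 0"
proof -
  interpret t_structure "Obj C" "shift C" "ex_triangle C" "orthogonal C" "isomorphic C" L G
    by (rule t_structure[OF assms])
  show ?thesis
    using shift_set_eq[OF G_Ob, of "- (int m - 1)"] shift_set_eq[OF L_Ob, of 0]
    by (simp add: extended_heart_def t_interval_def interval_def le_def ge_def)
qed

lemma interval_torsion_pair:
  assumes t: "bounded_t_structure C L G" and p: "torsion_pair C L G m T F" and m: "m \<ge> 1"
  shows "interval_torsion_pair (Obj C) (shift C) (ex_triangle C) (orthogonal C) (isomorphic C)
    L G T F (- (int m - 1)) 0 m"
proof (intro interval_torsion_pair.intro t_structure[OF t] interval_torsion_pair_axioms.intro)
  from p have T: "subcategory C T" and F: "subcategory C F" and o: "Hom_vanish C T F"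
    and H: "T \<subseteq> extended_heart C L G m" "F \<subseteq> extended_heart C L G m"
    and s: "extended_heart C L G m = star C T F"
    unfolding torsion_pair_def by blast+
  show "Y \<in> T" if "X \<in> T" "Y \<in> Obj C" "isomorphic C X Y" for X Y
    by (rule subcategoryD(2)[OF T that])
  show "Y \<in> F" if "X \<in> F" "Y \<in> Obj C" "isomorphic C X Y" for X Y
    by (rule subcategoryD(2)[OF F that])
  show "\<exists>N \<in> T. orthogonal C N N" "\<exists>N \<in> F. orthogonal C N N"
    by (rule subcategoryD(3)[OF T], rule subcategoryD(3)[OF F])
  show "T \<subseteq> t_structure.interval (Obj C) (shift C) L G (- (int m - 1)) 0"
    "F \<subseteq> t_structure.interval (Obj C) (shift C) L G (- (int m - 1)) 0"
    using H unfolding extended_heart_eq_interval[OF t] .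
  show "orthogonal C X Y" if "X \<in> T" "Y \<in> F" for X Y
    using o that by (simp add: Hom_vanish_def orthogonal_def)
  show "\<exists>X \<in> T. \<exists>Y \<in> F. ex_triangle C X Z Y"
    if "Z \<in> t_structure.interval (Obj C) (shift C) L G (- (int m - 1)) 0" for Z
  proof -
    have "Z \<in> star C T F" using that unfolding s[symmetric] extended_heart_eq_interval[OF t] .
    then show ?thesis by (auto simp: star_def)
  qed
qed (use m in auto)

end

theorem proposition1p18:
  fixes D :: "('o, 'a) triangulated_category"
    and L G T F :: "'o set" and m :: nat
  assumes "m \<ge> 1"
    and "triangulated_category D"
    and "bounded_t_structure D L G"
    and "torsion_pair D L G m T F"
  shows "(s_torsion_pair D L G m T F \<longleftrightarrow> Fac D L G m T \<subseteq> T) \<and>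
         (Fac D L G m T \<subseteq> T \<longleftrightarrow> Sub D L G m F \<subseteq> F)"
proof -
  interpret D: triangulated_category D by (rule assms(2))
  interpret interval_torsion_pair "Obj D" "shift D" "ex_triangle D" "orthogonal D" "isomorphic D"
      L G T F "- (int m - 1)" 0 m
    using D.interval_torsion_pair assms by blast
  note H = D.extended_heart_eq_interval[OF assms(3), of m]
  have "s_torsion_pair D L G m T F \<longleftrightarrow> strong"
    using assms(4)
    by (simp add: s_torsion_pair_def strong_def Hom_vanish_def orthogonal_def shift_set_def)
  moreover have "Fac D L G m T = factors (ex_triangle D) (interval (- (int m - 1)) 0) T m"
    unfolding factors_eq_sequences Fac_def H ..
  moreover have "Sub D L G m F =
      factors (\<lambda>X Y Z. ex_triangle D Z Y X) (interval (- (int m - 1)) 0) F m"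
    unfolding factors_eq_sequences Sub_def H ..
  ultimately show ?thesis
    using strong_iff_factors_subset strong_iff_subobjects_subset by simp
qed

end
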